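(* Let $p\ge 13$ be a prime number. The metric group $(\mathbb{Z}(p),d_{Lee})$ does not belong to $\mathcal{G}_{sof}\cup\mathcal{G}_{hyplin}\cup\mathcal{G}_{l.sof}$.
   Context: $\mathbb{Z}(p)$ is the cyclic group $\mathbb{Z}/p\mathbb{Z}$ (written additively, elements represented by $a\in\{0,\dots,p-1\}$), with the Lee norm $l_{Lee}(a)=\frac{2\min(a,p-a)}{p-1}$ and the Lee distance $d_{Lee}(a,b)=l_{Lee}(a-b)$. $\mathcal{G}$ is the class of all metric groups $(G,d)$ with complete bi-invariant metric $d\le1$. The metric ultraproduct of groups $(G_i,d_i)$, $i\in I$, with uniformly bounded bi-invariant metrics, with respect to an ultrafilter $\Phi$ on $I$, is $(\prod_I G_i)/N$, where $N=\{(x_i):\lim_{i\to\Phi}d_i(x_i,1)=0\}$, with the metric $d(xN,yN)=\lim_{i\to\Phi}d_i(x_i,y_i)$. $\mathcal{G}_{sof}$ (sofic metric groups): those $(G,d)\in\mathcal{G}$ which embed by an isometric homomorphism as closed subgroups into a metric ultraproduct of finite symmetric groups $S_n$ with Hamming metrics $d_H(g,h)=1-|Fix(g^{-1}h)|/n$. $\mathcal{G}_{hyplin}$ (hyperlinear metric groups): those which embed isometrically into a metric ultraproduct of finite-dimensional unitary groups $U(n)$ with the metrics $\frac12 d_{HS}$, where $d_{HS}(u,v)=\sqrt{\frac1n\mathrm{tr}((u-v)^*(u-v))}$ is the normalized Hilbert–Schmidt metric. $\mathcal{G}_{l.sof}$ (linear sofic metric groups): those which embed isometrically into a metric ultraproduct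 of groups $GL_n(\mathbb{C})$ with the metrics $\rho(a,b)=\frac1n\mathrm{rk}(a-b)$. *)

theory Defs
  imports
    "HOL-Analysis.Abstract_Metric_Spaces"
    "HOL-Algebra.Product_Groups"
    "HOL-Algebra.Sym_Groups"
    "HOL-Computational_Algebra.Primes"
    "Jordan_Normal_Form.Schur_Decomposition"
    "Jordan_Normal_Form.DL_Rank"
begin

section \<open>Metric groups\<close>

definition bi_invariant :: "'a monoid \<Rightarrow> ('a \<Rightarrow> 'a \<Rightarrow> real) \<Rightarrow> bool" where
  "bi_invariant G d \<longleftrightarrow>
     (\<forall>x\<in>carrier G. \<forall>y\<in>carrier G. \<forall>z\<in>carrier G.
        d (x \<otimes>\<^bsub>G\<^esub> y) (x \<otimes>\<^bsub>G\<^esub> z) = d y z \<and> d (y \<otimes>\<^bsub>G\<^esub> x) (z \<otimes>\<^bsub>G\<^esub> x) = d y z)"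

definition metric_groups :: "('a monoid \<times> ('a \<Rightarrow> 'a \<Rightarrow> real)) set" where
  "metric_groups = {(G, d).
     group G \<and> Metric_space (carrier G) d \<and> Metric_space.mcomplete (carrier G) d \<and>
     bi_invariant G d \<and> (\<forall>x\<in>carrier G. \<forall>y\<in>carrier G. d x y \<le> 1)}"

definition isometric_hom ::
  "'a monoid \<Rightarrow> ('a \<Rightarrow> 'a \<Rightarrow> real) \<Rightarrow> 'b monoid \<Rightarrow> ('b \<Rightarrow> 'b \<Rightarrow> real) \<Rightarrow> ('a \<Rightarrow> 'b) \<Rightarrow> bool" where
  "isometric_hom G d H e h \<longleftrightarrow>
     h \<in> hom G H \<and> (\<forall>x\<in>carrier G. \<forall>y\<in>carrier G. e (h x) (h y) = d x y)"


section \<open>Metric ultraproducts\<close>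

definition ultrafilter :: "'i filter \<Rightarrow> bool" where
  "ultrafilter \<Phi> \<longleftrightarrow>
     \<Phi> \<noteq> bot \<and> (\<forall>P. eventually P \<Phi> \<or> eventually (\<lambda>i. \<not> P i) \<Phi>)"

definition ultra_null ::
  "'i filter \<Rightarrow> ('i \<Rightarrow> 'b monoid) \<Rightarrow> ('i \<Rightarrow> 'b \<Rightarrow> 'b \<Rightarrow> real) \<Rightarrow> ('i \<Rightarrow> 'b) set" where
  "ultra_null \<Phi> G d =
     {x \<in> carrier (product_group UNIV G). ((\<lambda>i. d i (x i) \<one>\<^bsub>G i\<^esub>) \<longlongrightarrow> 0) \<Phi>}"

definition ultraproduct ::
  "'i filter \<Rightarrow> ('i \<Rightarrow> 'b monoid) \<Rightarrow> ('i \<Rightarrow> 'b \<Rightarrow> 'b \<Rightarrow> real) \<Rightarrow> ('i \<Rightarrow> 'b) set monoid" where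
  "ultraproduct \<Phi> G d = product_group UNIV G Mod ultra_null \<Phi> G d"

text \<open>
  For uniformly bounded bi-invariant metrics the limit along an ultrafilter exists and depends only
  on the cosets \<open>A\<close> and \<open>B\<close>. The value \<open>0\<close> off the carrier is a convention: the locale
  \<open>Metric_space\<close> demands nonnegativity and symmetry on the whole type.
\<close>
definition ultraproduct_dist ::
  "'i filter \<Rightarrow> ('i \<Rightarrow> 'b monoid) \<Rightarrow> ('i \<Rightarrow> 'b \<Rightarrow> 'b \<Rightarrow> real) \<Rightarrow>
     ('i \<Rightarrow> 'b) set \<Rightarrow> ('i \<Rightarrow> 'b) set \<Rightarrow> real" where
  "ultraproduct_dist \<Phi> G d A B =
     (if A \<in> carrier (ultraproduct \<Phi> G d) \<and> B \<in> carrier (ultraproduct \<Phi> G d)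
      then THE r. \<exists>x\<in>A. \<exists>y\<in>B. ((\<lambda>i. d i (x i) (y i)) \<longlongrightarrow> r) \<Phi>
      else 0)"


section \<open>The approximating families\<close>

definition hamming_dist :: "nat \<Rightarrow> (nat \<Rightarrow> nat) \<Rightarrow> (nat \<Rightarrow> nat) \<Rightarrow> real" where
  "hamming_dist n g h =
     1 - real (card {k \<in> {1..n}. (inv\<^bsub>sym_group n\<^esub> g \<otimes>\<^bsub>sym_group n\<^esub> h) k = k}) / real n"

definition unitary_group :: "nat \<Rightarrow> complex mat monoid" where
  "unitary_group n =
     \<lparr>carrier = {u \<in> carrier_mat n n. mat_adjoint u * u = 1\<^sub>m n \<and> u * mat_adjoint u = 1\<^sub>m n},
      monoid.mult = (*), one = 1\<^sub>m n\<rparr>"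

definition mat_trace :: "complex mat \<Rightarrow> complex" where
  "mat_trace A = (\<Sum>i<dim_row A. A $$ (i, i))"

text \<open>The trace below is a nonnegative real, so taking its real part is only a coercion.\<close>
definition hs_dist :: "nat \<Rightarrow> complex mat \<Rightarrow> complex mat \<Rightarrow> real" where
  "hs_dist n u v = sqrt (1 / real n * Re (mat_trace (mat_adjoint (u - v) * (u - v))))"

definition GL_group :: "nat \<Rightarrow> complex mat monoid" where
  "GL_group n = units_of (ring_mat TYPE(complex) n ())"

definition rank_dist :: "nat \<Rightarrow> complex mat \<Rightarrow> complex mat \<Rightarrow> real" where
  "rank_dist n a b = 1 / real n * real (vec_space.rank n (a - b))"


section \<open>Sofic, hyperlinear and linear sofic metric groups\<close>

text \<open>
  The index set of the ultraproduct is the type \<open>'i\<close>. HOL cannot quantify over types inside a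
  formula, so the index type is a parameter of each class; a statement about all metric
  ultraproducts is one in which this type is left arbitrary.
\<close>

definition sofic_metric_groups :: "'i itself \<Rightarrow> ('a monoid \<times> ('a \<Rightarrow> 'a \<Rightarrow> real)) set" where
  "sofic_metric_groups (ty :: 'i itself) = {(G, d) \<in> metric_groups.
     \<exists>(\<Phi> :: 'i filter) (n :: 'i \<Rightarrow> nat). ultrafilter \<Phi> \<and> (\<forall>i. n i \<ge> 1) \<and>
       (let S = (\<lambda>i. sym_group (n i)); \<delta> = (\<lambda>i. hamming_dist (n i));
            H = ultraproduct \<Phi> S \<delta>; e = ultraproduct_dist \<Phi> S \<delta>
        in \<exists>h. isometric_hom G d H e h \<and>
               closedin (Metric_space.mtopology (carrier H) e) (h ` carrier G))}"

definition hyperlinear_metric_groups :: "'i itself \<Rightarrow> ('a monoid \<times> ('a \<Rightarrow> 'a \<Rightarrow> real)) set" where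
  "hyperlinear_metric_groups (ty :: 'i itself) = {(G, d) \<in> metric_groups.
     \<exists>(\<Phi> :: 'i filter) (n :: 'i \<Rightarrow> nat). ultrafilter \<Phi> \<and> (\<forall>i. n i \<ge> 1) \<and>
       (let U = (\<lambda>i. unitary_group (n i)); \<delta> = (\<lambda>i u v. 1 / 2 * hs_dist (n i) u v)
        in \<exists>h. isometric_hom G d (ultraproduct \<Phi> U \<delta>) (ultraproduct_dist \<Phi> U \<delta>) h)}"

definition linear_sofic_metric_groups :: "'i itself \<Rightarrow> ('a monoid \<times> ('a \<Rightarrow> 'a \<Rightarrow> real)) set" where
  "linear_sofic_metric_groups (ty :: 'i itself) = {(G, d) \<in> metric_groups.
     \<exists>(\<Phi> :: 'i filter) (n :: 'i \<Rightarrow> nat). ultrafilter \<Phi> \<and> (\<forall>i. n i \<ge> 1) \<and>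
       (let L = (\<lambda>i. GL_group (n i)); \<rho> = (\<lambda>i. rank_dist (n i))
        in \<exists>h. isometric_hom G d (ultraproduct \<Phi> L \<rho>) (ultraproduct_dist \<Phi> L \<rho>) h)}"


section \<open>The Lee metric\<close>

text \<open>Intended for representatives \<open>a \<in> {0..<int p}\<close>, the carrier of \<open>integer_mod_group p\<close>.\<close>
definition lee_norm :: "nat \<Rightarrow> int \<Rightarrow> real" where
  "lee_norm p a = 2 * real_of_int (min a (int p - a)) / (real p - 1)"

definition lee_dist :: "nat \<Rightarrow> int \<Rightarrow> int \<Rightarrow> real" where
  "lee_dist p a b = lee_norm p ((a - b) mod int p)"

lemma lee_min_commute:
  fixes a b p :: int
  assumes "p > 0"
  shows "min ((a - b) mod p) (p - (a - b) mod p) = min ((b - a) mod p) (p - (b - a) mod p)"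
proof -
  have "(b - a) mod p = (- (a - b)) mod p"
    by simp
  then show ?thesis
    using assms zmod_zminus1_eq_if[of "a - b" p] pos_mod_bound[of p "a - b"] pos_mod_sign[of p "a - b"]
    by (auto simp: min_def split: if_splits)
qed

lemma lee_min_triangle:
  fixes u v p :: int
  assumes "p > 0"
  shows "min ((u + v) mod p) (p - (u + v) mod p) \<le> min (u mod p) (p - u mod p) + min (v mod p) (p - v mod p)"
proof -
  define x y where "x = u mod p" and "y = v mod p"
  have xy: "0 \<le> x" "x < p" "0 \<le> y" "y < p"
    using assms by (auto simp: x_def y_def)
  have "(u + v) mod p = (x + y) mod p"
    by (simp add: x_def y_def mod_add_eq)
  also have "\<dots> = (if x + y < p then x + y else x + y - p)"
    using xy by (smt (verit) mod_pos_pos_trivial minus_mod_self2)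
  finally show ?thesis
    using xy unfolding x_def[symmetric] y_def[symmetric] by (auto simp: min_def)
qed

lemma lee_metric_group:
  assumes "p \<ge> 3" "odd p"
  shows "(integer_mod_group p, lee_dist p) \<in> metric_groups"
proof -
  let ?Z = "integer_mod_group p"
  have car: "carrier ?Z = {0..<int p}"
    using assms by (simp add: carrier_integer_mod_group)
  have pos: "int p > 0" "real p - 1 > 0"
    using assms by auto
  have ms: "Metric_space (carrier ?Z) (lee_dist p)"
  proof
    fix x y z
    have m: "(x - y) mod int p < int p" "(x - y) mod int p \<ge> 0"
      using pos by auto
    then have "0 \<le> min ((x - y) mod int p) (int p - (x - y) mod int p)"
      by linarith
    then show "0 \<le> lee_dist p x y"
      using pos unfolding lee_dist_def lee_norm_def
      by (intro divide_nonneg_pos mult_nonneg_nonneg) (simp_all del: of_int_min)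
    show "lee_dist p x y = lee_dist p y x"
      using lee_min_commute[OF pos(1)] by (simp add: lee_dist_def lee_norm_def)
    assume x: "x \<in> carrier ?Z" and y: "y \<in> carrier ?Z"
    have "lee_dist p x y = 0 \<longleftrightarrow> min ((x - y) mod int p) (int p - (x - y) mod int p) = 0"
      using pos by (simp add: lee_dist_def lee_norm_def del: of_int_min)
    also have "\<dots> \<longleftrightarrow> (x - y) mod int p = 0"
      using m by (auto simp: min_def)
    also have "\<dots> \<longleftrightarrow> x mod int p = y mod int p"
      by (simp add: mod_eq_dvd_iff dvd_eq_mod_eq_0)
    also have "\<dots> \<longleftrightarrow> x = y"
      using x y by (simp add: car)
    finally show "lee_dist p x y = 0 \<longleftrightarrow> x = y" .
    show "lee_dist p x z \<le> lee_dist p x y + lee_dist p y z"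
    proof -
      have "min ((x - z) mod int p) (int p - (x - z) mod int p)
          \<le> min ((x - y) mod int p) (int p - (x - y) mod int p) + min ((y - z) mod int p) (int p - (y - z) mod int p)"
        using lee_min_triangle[OF pos(1), of "x - y" "y - z"] by simp
      then show ?thesis
        using pos unfolding lee_dist_def lee_norm_def add_divide_distrib[symmetric] distrib_left[symmetric]
          of_int_add[symmetric]
        by (intro divide_right_mono mult_left_mono) (simp_all del: of_int_min of_int_add)
    qed
  qed
  have complete: "Metric_space.mcomplete (carrier ?Z) (lee_dist p)"
  proof -
    interpret Metric_space "carrier ?Z" "lee_dist p" by (rule ms)
    have "compactin mtopology (topspace mtopology)"
    proof (rule finite_imp_compactin)
      show "finite (topspace mtopology)"
        unfolding topspace_mtopology by (simp add: car)
    qed simp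
    then show ?thesis
      by (simp add: compact_space_def compact_space_imp_mcomplete)
  qed
  have inv: "bi_invariant ?Z (lee_dist p)"
    by (simp add: bi_invariant_def lee_dist_def mod_diff_eq)
  have "lee_dist p x y \<le> 1" for x y
  proof -
    have "2 * min ((x - y) mod int p) (int p - (x - y) mod int p) \<le> int p - 1"
    proof -
      have "2 * min r (q - r) \<le> q - 1" if "odd q" for q r :: int
        using that unfolding min_def by presburger
      then show ?thesis
        using \<open>odd p\<close> by simp
    qed
    then have "2 * real_of_int (min ((x - y) mod int p) (int p - (x - y) mod int p)) \<le> real p - 1"
      by linarith
    then show ?thesis
      using pos by (simp add: lee_dist_def lee_norm_def del: of_int_min)
  qed
  with ms complete inv show ?thesis
    by (simp add: metric_groups_def)
qed

end

theory Submission
  imports Defs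
begin

text \<open>
  Each family of approximating groups satisfies a closed inequality between the distances of
  powers of one element. Such an inequality passes to every metric ultraproduct, hence to every
  group isometrically embedded in one, and the Lee metric violates it.

  \<^item> If a permutation \<open>x\<close> fixes a point, so does \<open>x\<^sup>2\<close>; and \<open>x\<^sup>2 - 1 = (x - 1) (x + 1)\<close> has rank at
    most that of \<open>x - 1\<close> for a matrix \<open>x\<close>. So squaring never increases the length of an element
    of a symmetric group or of a general linear group. For the Lee norm, however, \<open>2\<close> is twice
    as long as \<open>1\<close>. The contradiction is derived in
    \<open>lee_not_embeddable_if_squaring_contracts\<close>.

  \<^item> The Hilbert-Schmidt metric is Euclidean: if \<open>m\<close> is a metric midpoint of \<open>a\<close> and \<open>b\<close>, then
    \<open>2 d(m, z) \<le> d(a, z) + d(b, z)\<close> for every \<open>z\<close>. The Lee metric is a cycle metric, and it fails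
    this inequality at the point where the cycle turns back. Write \<open>p = 2 q + 1\<close>, measure in units of
    the norm of \<open>1\<close>, and take \<open>z = 0\<close>, \<open>a = q - 1\<close>, \<open>m = q\<close>, \<open>b = q + 1\<close>. The distances to \<open>z\<close> are
    \<open>q - 1\<close>, \<open>q\<close>, \<open>q\<close>, and \<open>2 q \<le> (q - 1) + q\<close> is false. The quantitative form of the inequality,
    with the parallelogram defect as an error term, is \<open>hs_dist_euclidean\<close>, and the
    contradiction is derived in \<open>lee_not_embeddable_if_euclidean\<close>.

  The passage to the ultraproduct is \<open>ultraproduct_power_representatives\<close>. It lifts the image of a
  group element to a family \<open>x i\<close> such that the distances between powers of \<open>x i\<close> converge to
  the distances between the same powers of the element.
\<close>

section \<open>Ultralimits and representatives of powers\<close>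

text \<open>By compactness the image filter has a cluster point in \<open>[0, C]\<close>, and along an ultrafilter a
  cluster point is a limit.\<close>

lemma ultralimit_exists:
  fixes f :: "'i \<Rightarrow> real"
  assumes "ultrafilter \<Phi>" and "\<And>i. 0 \<le> f i" and "\<And>i. f i \<le> C"
  shows "\<exists>r. (f \<longlongrightarrow> r) \<Phi>"
proof -
  have nb: "\<Phi> \<noteq> bot" and ultra: "\<And>P. eventually P \<Phi> \<or> eventually (\<lambda>i. \<not> P i) \<Phi>"
    using assms(1) by (auto simp: ultrafilter_def)
  have "filtermap f \<Phi> \<noteq> bot" "eventually (\<lambda>y. y \<in> {0..C}) (filtermap f \<Phi>)"
    using nb assms(2,3) by (auto simp: filtermap_bot_iff eventually_filtermap)
  then obtain r where r: "inf (nhds r) (filtermap f \<Phi>) \<noteq> bot"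
    using compact_Icc[of 0 C] unfolding compact_filter by blast
  have "eventually (\<lambda>i. f i \<in> S) \<Phi>" if S: "open S" "r \<in> S" for S
  proof (rule ccontr)
    assume "\<not> ?thesis"
    then have "eventually (\<lambda>y. y \<notin> S) (filtermap f \<Phi>)"
      using ultra[of "\<lambda>i. f i \<in> S"] by (simp add: eventually_filtermap)
    moreover have "eventually (\<lambda>y. y \<in> S) (nhds r)"
      using S by (rule eventually_nhds_in_open)
    ultimately have "eventually (\<lambda>_. False) (inf (nhds r) (filtermap f \<Phi>))"
      unfolding eventually_inf by (intro exI[of _ "\<lambda>y. y \<in> S"] exI[of _ "\<lambda>y. y \<notin> S"]) auto
    with r show False
      by (simp add: trivial_limit_def)
  qed
  then show ?thesis
    by (auto simp: tendsto_def)
qed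

text \<open>What the representatives of a coset need for the ultraproduct distance to be an honest limit.
  Cosets are right translates of the null sequences, so invariance under right translations is the
  relevant one.\<close>

locale right_invariant_pseudometric = group G for G :: "'b monoid" (structure) +
  fixes d :: "'b \<Rightarrow> 'b \<Rightarrow> real"
  assumes nonneg: "\<lbrakk>x \<in> carrier G; y \<in> carrier G\<rbrakk> \<Longrightarrow> 0 \<le> d x y"
    and le_one: "\<lbrakk>x \<in> carrier G; y \<in> carrier G\<rbrakk> \<Longrightarrow> d x y \<le> 1"
    and self: "x \<in> carrier G \<Longrightarrow> d x x = 0"
    and commute: "\<lbrakk>x \<in> carrier G; y \<in> carrier G\<rbrakk> \<Longrightarrow> d x y = d y x"
    and triangle: "\<lbrakk>x \<in> carrier G; y \<in> carrier G; z \<in> carrier G\<rbrakk> \<Longrightarrow> d x z \<le> d x y + d y z"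
    and right_invariant:
      "\<lbrakk>x \<in> carrier G; y \<in> carrier G; z \<in> carrier G\<rbrakk> \<Longrightarrow> d (x \<otimes> z) (y \<otimes> z) = d x y"

text \<open>Two representatives are \<open>u g\<close> and \<open>v g\<close> with null sequences \<open>u\<close> and \<open>v\<close>; right invariance
  cancels \<open>g\<close>, and both \<open>u\<close> and \<open>v\<close> are close to the identity.\<close>

lemma ultra_null_coset_tendsto:
  fixes G :: "'i \<Rightarrow> 'b monoid"
  assumes pm: "\<And>i. right_invariant_pseudometric (G i) (d i)"
    and A: "A \<in> carrier (ultraproduct \<Phi> G d)" and x: "x \<in> A" and x': "x' \<in> A"
  shows "((\<lambda>i. d i (x i) (x' i)) \<longlongrightarrow> 0) \<Phi>" and "x i \<in> carrier (G i)"
proof -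
  let ?P = "product_group UNIV G"
  obtain g where g: "g \<in> carrier ?P" and Ag: "A = ultra_null \<Phi> G d #>\<^bsub>?P\<^esub> g"
    using A by (auto simp: ultraproduct_def carrier_FactGroup)
  from x x' Ag obtain u v where u: "u \<in> ultra_null \<Phi> G d" "x = u \<otimes>\<^bsub>?P\<^esub> g"
    and v: "v \<in> ultra_null \<Phi> G d" "x' = v \<otimes>\<^bsub>?P\<^esub> g"
    unfolding r_coset_def by blast
  have c: "u i \<in> carrier (G i)" "v i \<in> carrier (G i)" "g i \<in> carrier (G i)" for i
    using u v g by (auto simp: ultra_null_def)
  have grp: "group (G i)" for i
    using pm[of i] by (simp add: right_invariant_pseudometric_def)
  show "x i \<in> carrier (G i)"
    using c[of i] grp[of i] u by (simp add: group.is_monoid monoid.m_closed)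
  have one: "\<one>\<^bsub>G i\<^esub> \<in> carrier (G i)" for i
    using grp[of i] by (simp add: group.is_monoid)
  have eq: "d i (x i) (x' i) = d i (u i) (v i)" for i
    using right_invariant_pseudometric.right_invariant[OF pm c(1,2,3)] u v by simp
  have "((\<lambda>i. d i (u i) \<one>\<^bsub>G i\<^esub> + d i (v i) \<one>\<^bsub>G i\<^esub>) \<longlongrightarrow> 0 + 0) \<Phi>"
    using u v by (intro tendsto_add) (auto simp: ultra_null_def)
  then have lim: "((\<lambda>i. d i (u i) \<one>\<^bsub>G i\<^esub> + d i (v i) \<one>\<^bsub>G i\<^esub>) \<longlongrightarrow> 0) \<Phi>"
    by simp
  show "((\<lambda>i. d i (x i) (x' i)) \<longlongrightarrow> 0) \<Phi>"
  proof (rule tendsto_sandwich[OF _ _ tendsto_const lim])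
    show "\<forall>\<^sub>F i in \<Phi>. 0 \<le> d i (x i) (x' i)"
      using right_invariant_pseudometric.nonneg[OF pm c(1,2)] by (simp add: eq)
    have "d i (u i) (v i) \<le> d i (u i) \<one>\<^bsub>G i\<^esub> + d i (v i) \<one>\<^bsub>G i\<^esub>" for i
      using right_invariant_pseudometric.triangle[OF pm c(1) one c(2)]
        right_invariant_pseudometric.commute[OF pm one c(2)] by simp
    then show "\<forall>\<^sub>F i in \<Phi>. d i (x i) (x' i) \<le> d i (u i) \<one>\<^bsub>G i\<^esub> + d i (v i) \<one>\<^bsub>G i\<^esub>"
      by (simp add: eq)
  qed
qed

text \<open>The distance of two cosets is defined by a definite description over representatives. Changing
  representatives changes the distances by a null sequence, so the description is unique and every
  choice of representatives computes it.\<close>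

lemma ultraproduct_dist_tendsto:
  fixes G :: "'i \<Rightarrow> 'b monoid"
  assumes ultra: "ultrafilter \<Phi>"
    and pm: "\<And>i. right_invariant_pseudometric (G i) (d i)"
    and A: "A \<in> carrier (ultraproduct \<Phi> G d)" and B: "B \<in> carrier (ultraproduct \<Phi> G d)"
    and x: "x \<in> A" and y: "y \<in> B"
  shows "((\<lambda>i. d i (x i) (y i)) \<longlongrightarrow> ultraproduct_dist \<Phi> G d A B) \<Phi>"
proof -
  have nb: "\<Phi> \<noteq> bot"
    using ultra by (simp add: ultrafilter_def)
  have car: "w i \<in> carrier (G i)" if "w \<in> A \<or> w \<in> B" for w i
    using that ultra_null_coset_tendsto(2)[OF pm A] ultra_null_coset_tendsto(2)[OF pm B] by blast
  obtain r where r: "((\<lambda>i. d i (x i) (y i)) \<longlongrightarrow> r) \<Phi>"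
    using ultralimit_exists[OF ultra, of "\<lambda>i. d i (x i) (y i)" 1] x y
      right_invariant_pseudometric.nonneg[OF pm car car] right_invariant_pseudometric.le_one[OF pm car car]
    by blast
  have uniq: "s = r" if x': "x' \<in> A" and y': "y' \<in> B"
    and s: "((\<lambda>i. d i (x' i) (y' i)) \<longlongrightarrow> s) \<Phi>" for s x' y'
  proof -
    have "((\<lambda>i. d i (x i) (x' i) + d i (y i) (y' i)) \<longlongrightarrow> 0 + 0) \<Phi>"
      by (intro tendsto_add ultra_null_coset_tendsto(1)[OF pm A x x']
          ultra_null_coset_tendsto(1)[OF pm B y y'])
    then have "((\<lambda>i. d i (x i) (x' i) + d i (y i) (y' i)) \<longlongrightarrow> 0) \<Phi>"
      by simp
    then have "((\<lambda>i. d i (x' i) (y' i) - d i (x i) (y i)) \<longlongrightarrow> 0) \<Phi>"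
    proof (rule Lim_null_comparison[rotated])
      have "\<bar>d i (x' i) (y' i) - d i (x i) (y i)\<bar> \<le> d i (x i) (x' i) + d i (y i) (y' i)" for i
      proof -
        interpret right_invariant_pseudometric "G i" "d i" by (rule pm)
        have c: "x i \<in> carrier (G i)" "y i \<in> carrier (G i)"
          "x' i \<in> carrier (G i)" "y' i \<in> carrier (G i)"
          using car x y x' y' by blast+
        show ?thesis
          using triangle[of "x' i" "x i" "y' i"] triangle[of "x i" "y i" "y' i"]
            triangle[of "x i" "x' i" "y i"] triangle[of "x' i" "y' i" "y i"]
            commute[of "x i" "x' i"] commute[of "y i" "y' i"] c by linarith
      qed
      then show "\<forall>\<^sub>F i in \<Phi>. norm (d i (x' i) (y' i) - d i (x i) (y i))
          \<le> d i (x i) (x' i) + d i (y i) (y' i)"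
        by simp
    qed
    from tendsto_add[OF this r] have "((\<lambda>i. d i (x' i) (y' i)) \<longlongrightarrow> r) \<Phi>"
      by simp
    with s show ?thesis
      using nb by (blast intro: tendsto_unique)
  qed
  have "(THE r. \<exists>x\<in>A. \<exists>y\<in>B. ((\<lambda>i. d i (x i) (y i)) \<longlongrightarrow> r) \<Phi>) = r"
    using r x y uniq by (intro the_equality) blast+
  with r show ?thesis
    using A B by (simp add: ultraproduct_dist_def)
qed

text \<open>Any representative \<open>x\<close> of \<open>h a\<close> will do. Products in the quotient are products of
  sets, so \<open>x\<^sup>k\<close> lies in the coset \<open>h (a\<^sup>k)\<close> for every positive \<open>k\<close>. The exponents start at \<open>1\<close>
  because this argument is silent about the zeroth power; translation makes positive exponents
  sufficient.\<close>

lemma ultraproduct_power_representatives: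
  fixes G :: "'i \<Rightarrow> 'b monoid" and K :: "'a monoid"
  assumes ultra: "ultrafilter \<Phi>"
    and pm: "\<And>i. right_invariant_pseudometric (G i) (d i)"
    and h: "isometric_hom K \<delta> (ultraproduct \<Phi> G d) (ultraproduct_dist \<Phi> G d) h"
    and K: "group K" and a: "a \<in> carrier K"
  obtains x where "\<And>i. x i \<in> carrier (G i)"
    and "\<And>k l. ((\<lambda>i. d i (x i [^]\<^bsub>G i\<^esub> Suc k) (x i [^]\<^bsub>G i\<^esub> Suc l))
           \<longlongrightarrow> \<delta> (a [^]\<^bsub>K\<^esub> Suc k) (a [^]\<^bsub>K\<^esub> Suc l)) \<Phi>"
proof -
  let ?P = "product_group UNIV G" and ?U = "ultraproduct \<Phi> G d" and ?N = "ultra_null \<Phi> G d"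
  interpret K: group K by (rule K)
  have hom: "h \<in> hom K ?U"
    and iso: "\<And>x y. \<lbrakk>x \<in> carrier K; y \<in> carrier K\<rbrakk> \<Longrightarrow> ultraproduct_dist \<Phi> G d (h x) (h y) = \<delta> x y"
    using h by (auto simp: isometric_hom_def)
  have hU: "h x \<in> carrier ?U" if "x \<in> carrier K" for x
    using hom that by (auto simp: hom_def)
  have grp: "group (G i)" for i
    using pm[of i] by (simp add: right_invariant_pseudometric_def)
  have one: "\<one>\<^bsub>G i\<^esub> \<in> carrier (G i)" for i
    using grp[of i] by (simp add: group.is_monoid)
  obtain x where x: "x \<in> carrier ?P" and hx: "h a = ?N #>\<^bsub>?P\<^esub> x"
    using hU[OF a] by (auto simp: ultraproduct_def carrier_FactGroup)
  have "\<one>\<^bsub>?P\<^esub> \<in> ?N"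
    using one right_invariant_pseudometric.self[OF pm one] by (simp add: ultra_null_def)
  moreover have "\<one>\<^bsub>?P\<^esub> \<otimes>\<^bsub>?P\<^esub> x = x"
    using x grp by (intro monoid.l_one group.is_monoid product_group) auto
  ultimately have xa: "x \<in> h a"
    unfolding hx r_coset_def by (metis (no_types, lifting) UN_iff singletonI)
  have pow: "(\<lambda>i. x i [^]\<^bsub>G i\<^esub> Suc k) \<in> h (a [^]\<^bsub>K\<^esub> Suc k)" for k
  proof (induction k)
    case 0
    have "(\<lambda>i. x i [^]\<^bsub>G i\<^esub> Suc 0) = x"
      using x grp by (simp add: fun_eq_iff group.is_monoid monoid.l_one PiE_iff)
    then show ?case
      using xa a by simp
  next
    case (Suc k)
    let ?y = "\<lambda>i. x i [^]\<^bsub>G i\<^esub> Suc k"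
    have "h (a [^]\<^bsub>K\<^esub> Suc (Suc k)) = h (a [^]\<^bsub>K\<^esub> Suc k) \<otimes>\<^bsub>?U\<^esub> h a"
      using hom_mult[OF hom K.nat_pow_closed[OF a, of "Suc k"] a] by simp
    also have "\<dots> = h (a [^]\<^bsub>K\<^esub> Suc k) <#>\<^bsub>?P\<^esub> h a"
      by (simp add: ultraproduct_def)
    finally have "?y \<otimes>\<^bsub>?P\<^esub> x \<in> h (a [^]\<^bsub>K\<^esub> Suc (Suc k))"
      using Suc.IH xa unfolding set_mult_def by blast
    then show ?case
      by (simp add: restrict_def)
  qed
  show thesis
  proof (rule that)
    show "x i \<in> carrier (G i)" for i
      using x by auto
    fix k l
    have c: "a [^]\<^bsub>K\<^esub> Suc k \<in> carrier K" "a [^]\<^bsub>K\<^esub> Suc l \<in> carrier K"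
      using a K.nat_pow_closed by blast+
    show "((\<lambda>i. d i (x i [^]\<^bsub>G i\<^esub> Suc k) (x i [^]\<^bsub>G i\<^esub> Suc l))
           \<longlongrightarrow> \<delta> (a [^]\<^bsub>K\<^esub> Suc k) (a [^]\<^bsub>K\<^esub> Suc l)) \<Phi>"
      using ultraproduct_dist_tendsto[OF ultra pm hU[OF c(1)] hU[OF c(2)] pow pow]
      by (simp only: iso[OF c])
  qed
qed

section \<open>Inequalities violated by the Lee metric\<close>

lemma lee_dist_power_one:
  assumes "p > 1" and "l \<le> k" and "k - l < p"
  shows "lee_dist p (1 [^]\<^bsub>integer_mod_group p\<^esub> k) (1 [^]\<^bsub>integer_mod_group p\<^esub> l)
    = 2 * min (real k - real l) (real p - (real k - real l)) / (real p - 1)"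
proof -
  have "0 \<le> int k - int l" "int k - int l < int p"
    using assms by linarith+
  then have "(int k mod int p - int l mod int p) mod int p = int k - int l"
    by (simp add: mod_diff_eq)
  then show ?thesis
    by (simp add: lee_dist_def lee_norm_def of_int_min)
qed

text \<open>The hypothesis says that \<open>x\<^sup>2\<close> is at most as long as \<open>x\<close>, translated by \<open>x\<close> so that only positive
  powers occur. In the limit it would bound the Lee norm of \<open>2\<close>, which is \<open>4 / (p - 1)\<close>, by that
  of \<open>1\<close>, which is \<open>2 / (p - 1)\<close>. From \<open>p = 5\<close> on the residue \<open>2\<close> is no closer to \<open>0\<close> the other way
  round.\<close>

lemma lee_not_embeddable_if_squaring_contracts:
  fixes G :: "'i \<Rightarrow> 'b monoid"
  assumes "p \<ge> 5" and ultra: "ultrafilter \<Phi>"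
    and pm: "\<And>i. right_invariant_pseudometric (G i) (d i)"
    and short: "\<And>i x. x \<in> carrier (G i) \<Longrightarrow>
      d i (x \<otimes>\<^bsub>G i\<^esub> x \<otimes>\<^bsub>G i\<^esub> x) x \<le> d i (x \<otimes>\<^bsub>G i\<^esub> x) x"
  shows "\<not> isometric_hom (integer_mod_group p) (lee_dist p)
    (ultraproduct \<Phi> G d) (ultraproduct_dist \<Phi> G d) h"
proof
  assume h: "isometric_hom (integer_mod_group p) (lee_dist p)
    (ultraproduct \<Phi> G d) (ultraproduct_dist \<Phi> G d) h"
  have one: "1 \<in> carrier (integer_mod_group p)"
    using assms(1) by simp
  obtain x where x: "\<And>i. x i \<in> carrier (G i)"
    and lim: "\<And>k l. ((\<lambda>i. d i (x i [^]\<^bsub>G i\<^esub> Suc k) (x i [^]\<^bsub>G i\<^esub> Suc l))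
      \<longlongrightarrow> lee_dist p (1 [^]\<^bsub>integer_mod_group p\<^esub> Suc k) (1 [^]\<^bsub>integer_mod_group p\<^esub> Suc l)) \<Phi>"
    by (rule ultraproduct_power_representatives[OF ultra pm h group_integer_mod_group one])
      (rule that)
  have pow: "x i [^]\<^bsub>G i\<^esub> Suc 0 = x i" "x i [^]\<^bsub>G i\<^esub> Suc 1 = x i \<otimes>\<^bsub>G i\<^esub> x i"
    "x i [^]\<^bsub>G i\<^esub> Suc 2 = x i \<otimes>\<^bsub>G i\<^esub> x i \<otimes>\<^bsub>G i\<^esub> x i" for i
    using pm[of i] x[of i]
    by (simp_all add: right_invariant_pseudometric_def group.is_monoid monoid.l_one numeral_2_eq_2)
  have "lee_dist p (1 [^]\<^bsub>integer_mod_group p\<^esub> Suc 2) (1 [^]\<^bsub>integer_mod_group p\<^esub> Suc 0)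
     \<le> lee_dist p (1 [^]\<^bsub>integer_mod_group p\<^esub> Suc 1) (1 [^]\<^bsub>integer_mod_group p\<^esub> Suc 0)"
  proof (rule tendsto_le[OF _ lim lim])
    show "\<Phi> \<noteq> bot"
      using ultra by (simp add: ultrafilter_def)
    show "\<forall>\<^sub>F i in \<Phi>. d i (x i [^]\<^bsub>G i\<^esub> Suc 2) (x i [^]\<^bsub>G i\<^esub> Suc 0)
        \<le> d i (x i [^]\<^bsub>G i\<^esub> Suc 1) (x i [^]\<^bsub>G i\<^esub> Suc 0)"
      unfolding pow by (intro always_eventually allI short x)
  qed
  moreover have "lee_dist p (1 [^]\<^bsub>integer_mod_group p\<^esub> Suc 2) (1 [^]\<^bsub>integer_mod_group p\<^esub> Suc 0) = 4 / (real p - 1)"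
    "lee_dist p (1 [^]\<^bsub>integer_mod_group p\<^esub> Suc 1) (1 [^]\<^bsub>integer_mod_group p\<^esub> Suc 0) = 2 / (real p - 1)"
    using assms(1) by (subst lee_dist_power_one; simp)+
  ultimately have "4 / (real p - 1) \<le> 2 / (real p - 1)"
    by (simp only:)
  then show False
    using assms(1) by (simp add: divide_simps)
qed

text \<open>With \<open>p = 2 q + 1\<close> the points \<open>z, a, m, b\<close> are the residues \<open>1, q, q + 1, q + 2\<close>. The Lee distances
  are \<open>1 / q\<close> between neighbours and \<open>2 / q\<close> between \<open>a\<close> and \<open>b\<close>, so the square root vanishes. The
  distances to \<open>z\<close> are \<open>(q - 1) / q, 1, 1\<close>, because \<open>b\<close> is already past the antipode of \<open>z\<close>.\<close>

lemma lee_not_embeddable_if_euclidean: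
  fixes G :: "'i \<Rightarrow> 'b monoid"
  assumes "p \<ge> 5" and "odd p" and ultra: "ultrafilter \<Phi>"
    and pm: "\<And>i. right_invariant_pseudometric (G i) (d i)"
    and euclid: "\<And>i z a m b. \<lbrakk>z \<in> carrier (G i); a \<in> carrier (G i); m \<in> carrier (G i); b \<in> carrier (G i)\<rbrakk>
      \<Longrightarrow> 2 * d i m z \<le> d i a z + d i b z + sqrt (2 * (d i m a)\<^sup>2 + 2 * (d i b m)\<^sup>2 - (d i b a)\<^sup>2)"
  shows "\<not> isometric_hom (integer_mod_group p) (lee_dist p)
    (ultraproduct \<Phi> G d) (ultraproduct_dist \<Phi> G d) h"
proof
  assume h: "isometric_hom (integer_mod_group p) (lee_dist p)
    (ultraproduct \<Phi> G d) (ultraproduct_dist \<Phi> G d) h"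
  have one: "1 \<in> carrier (integer_mod_group p)"
    using assms(1) by simp
  obtain x where x: "\<And>i. x i \<in> carrier (G i)"
    and lim: "\<And>k l. ((\<lambda>i. d i (x i [^]\<^bsub>G i\<^esub> Suc k) (x i [^]\<^bsub>G i\<^esub> Suc l))
      \<longlongrightarrow> lee_dist p (1 [^]\<^bsub>integer_mod_group p\<^esub> Suc k) (1 [^]\<^bsub>integer_mod_group p\<^esub> Suc l)) \<Phi>"
    by (rule ultraproduct_power_representatives[OF ultra pm h group_integer_mod_group one])
      (rule that)
  \<comment> \<open>The limit distance between the powers with exponents \<open>k + 1\<close> and \<open>l + 1\<close>.\<close>
  define c where "c k l = lee_dist p (1 [^]\<^bsub>integer_mod_group p\<^esub> Suc k) (1 [^]\<^bsub>integer_mod_group p\<^esub> Suc l)" for k l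
  note lim = lim[folded c_def]
  obtain q where q: "p = Suc (2 * q)" "q \<ge> 2"
    using assms(1,2) by (auto elim!: oddE)
  obtain r where r: "q = Suc r"
    using q(2) by (cases q) auto
  have c: "c k l = min (real k - real l) (real p - (real k - real l)) / q"
    if "l \<le> k" "k - l < p" for k l
    using that lee_dist_power_one[of p "Suc l" "Suc k"] q by (simp add: c_def field_simps del: pow_integer_mod_group)
  have pow: "x i [^]\<^bsub>G i\<^esub> k \<in> carrier (G i)" for i and k :: nat
    using pm[of i] x[of i] by (simp add: right_invariant_pseudometric_def group.is_monoid monoid.nat_pow_closed)
  have "2 * c q 0 \<le> c r 0 + c (Suc q) 0 + sqrt (2 * (c q r)\<^sup>2 + 2 * (c (Suc q) q)\<^sup>2 - (c (Suc q) r)\<^sup>2)"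
  proof (rule tendsto_le)
    show "\<Phi> \<noteq> bot"
      using ultra by (simp add: ultrafilter_def)
    show "((\<lambda>i. 2 * d i (x i [^]\<^bsub>G i\<^esub> Suc q) (x i [^]\<^bsub>G i\<^esub> Suc 0)) \<longlongrightarrow> 2 * c q 0) \<Phi>"
      by (intro tendsto_intros lim)
    show "((\<lambda>i. d i (x i [^]\<^bsub>G i\<^esub> Suc r) (x i [^]\<^bsub>G i\<^esub> Suc 0) + d i (x i [^]\<^bsub>G i\<^esub> Suc (Suc q)) (x i [^]\<^bsub>G i\<^esub> Suc 0)
       + sqrt (2 * (d i (x i [^]\<^bsub>G i\<^esub> Suc q) (x i [^]\<^bsub>G i\<^esub> Suc r))\<^sup>2
             + 2 * (d i (x i [^]\<^bsub>G i\<^esub> Suc (Suc q)) (x i [^]\<^bsub>G i\<^esub> Suc q))\<^sup>2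
             - (d i (x i [^]\<^bsub>G i\<^esub> Suc (Suc q)) (x i [^]\<^bsub>G i\<^esub> Suc r))\<^sup>2))
      \<longlongrightarrow> c r 0 + c (Suc q) 0 + sqrt (2 * (c q r)\<^sup>2 + 2 * (c (Suc q) q)\<^sup>2 - (c (Suc q) r)\<^sup>2)) \<Phi>"
      by (intro tendsto_intros lim)
    show "\<forall>\<^sub>F i in \<Phi>. 2 * d i (x i [^]\<^bsub>G i\<^esub> Suc q) (x i [^]\<^bsub>G i\<^esub> Suc 0)
      \<le> d i (x i [^]\<^bsub>G i\<^esub> Suc r) (x i [^]\<^bsub>G i\<^esub> Suc 0) + d i (x i [^]\<^bsub>G i\<^esub> Suc (Suc q)) (x i [^]\<^bsub>G i\<^esub> Suc 0)
       + sqrt (2 * (d i (x i [^]\<^bsub>G i\<^esub> Suc q) (x i [^]\<^bsub>G i\<^esub> Suc r))\<^sup>2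
             + 2 * (d i (x i [^]\<^bsub>G i\<^esub> Suc (Suc q)) (x i [^]\<^bsub>G i\<^esub> Suc q))\<^sup>2
             - (d i (x i [^]\<^bsub>G i\<^esub> Suc (Suc q)) (x i [^]\<^bsub>G i\<^esub> Suc r))\<^sup>2)"
      by (intro always_eventually allI euclid pow)
  qed
  moreover have "c q 0 = 1" "c r 0 = 1 - 1 / q" "c (Suc q) 0 = 1"
    "c q r = 1 / q" "c (Suc q) q = 1 / q" "c (Suc q) r = 2 / q"
    using q(1,2) r by (simp_all add: c divide_simps)
  ultimately show False
    using q(2) by (simp add: power_divide)
qed

section \<open>Symmetric groups\<close>

lemma hamming_dist_eq:
  assumes "g permutes {1..n}" "h permutes {1..n}" "n \<ge> 1"
  shows "hamming_dist n g h = real (card {k \<in> {1..n}. g k \<noteq> h k}) / real n"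
proof -
  have "(inv\<^bsub>sym_group n\<^esub> g \<otimes>\<^bsub>sym_group n\<^esub> h) k = k \<longleftrightarrow> g k = h k" for k
  proof -
    have "(inv\<^bsub>sym_group n\<^esub> g \<otimes>\<^bsub>sym_group n\<^esub> h) k = inv' g (h k)"
      using assms(1) by (simp add: sym_group_carrier sym_group_mult)
    then show ?thesis
      using permutes_inverses[OF assms(1)] by metis
  qed
  then have "hamming_dist n g h = 1 - real (card {k \<in> {1..n}. g k = h k}) / real n"
    by (simp add: hamming_dist_def)
  moreover have "card {k \<in> {1..n}. g k = h k} + card {k \<in> {1..n}. g k \<noteq> h k} = card {1..n}"
  proof -
    have "card {k \<in> {1..n}. g k = h k} + card {k \<in> {1..n}. g k \<noteq> h k}
      = card ({k \<in> {1..n}. g k = h k} \<union> {k \<in> {1..n}. g k \<noteq> h k})"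
      by (intro card_Un_disjoint[symmetric]) auto
    moreover have "{k \<in> {1..n}. g k = h k} \<union> {k \<in> {1..n}. g k \<noteq> h k} = {1..n}"
      by blast
    ultimately show ?thesis
      by (simp only:)
  qed
  then have "real (card {k \<in> {1..n}. g k = h k}) = real n - real (card {k \<in> {1..n}. g k \<noteq> h k})"
    by simp
  ultimately show ?thesis
    using assms(3) by (simp add: diff_divide_distrib)
qed

lemma sym_group_pseudometric:
  assumes n: "n \<ge> 1"
  shows "right_invariant_pseudometric (sym_group n) (hamming_dist n)"
proof -
  interpret group "sym_group n" by (rule sym_group_is_group)
  show ?thesis
  proof
    fix x y assume "x \<in> carrier (sym_group n)" "y \<in> carrier (sym_group n)"
    then have xy: "x permutes {1..n}" "y permutes {1..n}"
      by (simp_all add: sym_group_carrier)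
    note eq = hamming_dist_eq[OF _ _ n]
    show "0 \<le> hamming_dist n x y"
      using xy by (simp add: eq)
    have "{k \<in> {1..n}. x k \<noteq> y k} = {k \<in> {1..n}. y k \<noteq> x k}"
      by auto
    then show "hamming_dist n x y = hamming_dist n y x"
      by (simp only: eq[OF xy] eq[OF xy(2,1)])
    have "card {k \<in> {1..n}. x k \<noteq> y k} \<le> card {1..n}"
      by (intro card_mono) auto
    then show "hamming_dist n x y \<le> 1"
      using xy n by (simp add: eq)
    fix z assume "z \<in> carrier (sym_group n)"
    then have z: "z permutes {1..n}"
      by (simp add: sym_group_carrier)
    have "card {k \<in> {1..n}. x k \<noteq> z k} \<le> card ({k \<in> {1..n}. x k \<noteq> y k} \<union> {k \<in> {1..n}. y k \<noteq> z k})"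
      by (intro card_mono) auto
    also have "\<dots> \<le> card {k \<in> {1..n}. x k \<noteq> y k} + card {k \<in> {1..n}. y k \<noteq> z k}"
      by (rule card_Un_le)
    finally show "hamming_dist n x z \<le> hamming_dist n x y + hamming_dist n y z"
      using xy z n by (simp add: eq divide_simps flip: of_nat_add)
    have "card {k \<in> {1..n}. (x \<circ> z) k \<noteq> (y \<circ> z) k} = card (z ` {k \<in> {1..n}. (x \<circ> z) k \<noteq> (y \<circ> z) k})"
      using permutes_inj_on[OF z] by (intro card_image[symmetric])
    also have "z ` {k \<in> {1..n}. (x \<circ> z) k \<noteq> (y \<circ> z) k} = {k \<in> z ` {1..n}. x k \<noteq> y k}"
      by auto
    also have "z ` {1..n} = {1..n}"
      by (rule permutes_image[OF z])
    finally show "hamming_dist n (x \<otimes>\<^bsub>sym_group n\<^esub> z) (y \<otimes>\<^bsub>sym_group n\<^esub> z) = hamming_dist n x y"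
      using xy z by (simp add: eq sym_group_mult permutes_compose)
  next
    fix x assume "x \<in> carrier (sym_group n)"
    then show "hamming_dist n x x = 0"
      by (simp add: hamming_dist_eq[OF _ _ n] sym_group_carrier)
  qed
qed

text \<open>If \<open>x\<^sup>2\<close> and \<open>x\<close> agree at a point, so do \<open>x\<^sup>3\<close> and \<open>x\<close>.\<close>

lemma hamming_dist_square_le:
  assumes n: "n \<ge> 1" and x: "x \<in> carrier (sym_group n)"
  shows "hamming_dist n (x \<otimes>\<^bsub>sym_group n\<^esub> x \<otimes>\<^bsub>sym_group n\<^esub> x) x \<le> hamming_dist n (x \<otimes>\<^bsub>sym_group n\<^esub> x) x"
proof -
  have p: "x permutes {1..n}"
    using x by (simp add: sym_group_carrier)
  have "card {k \<in> {1..n}. (x \<circ> x \<circ> x) k \<noteq> x k} \<le> card {k \<in> {1..n}. (x \<circ> x) k \<noteq> x k}"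
    by (intro card_mono) auto
  then show ?thesis
    using p n by (simp add: sym_group_mult hamming_dist_eq permutes_compose divide_right_mono)
qed

section \<open>General linear groups\<close>

text \<open>The columns of \<open>A * B\<close> are linear combinations of the columns of \<open>A\<close>.\<close>

lemma rank_mult_le:
  fixes A B :: "complex mat"
  assumes A: "A \<in> carrier_mat n m" and B: "B \<in> carrier_mat m k"
  shows "vec_space.rank n (A * B) \<le> vec_space.rank n A"
proof -
  interpret vec_space "TYPE(complex)" n .
  let ?W = "span (set (cols A))" and ?X = "span (set (cols (A * B)))"
  have AB: "A * B \<in> carrier_mat n k"
    using A B by simp
  have cA: "set (cols A) \<subseteq> carrier_vec n" and cAB: "set (cols (A * B)) \<subseteq> carrier_vec n"
    using A AB cols_dim[of A] cols_dim[of "A * B"] by auto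
  have W: "subspace class_ring ?W V" and X: "subspace class_ring ?X V"
    using cA cAB span_is_subspace by auto
  have "set (cols (A * B)) \<subseteq> ?W"
  proof
    fix v assume "v \<in> set (cols (A * B))"
    then obtain j where j: "j < k" "v = col (A * B) j"
      using AB by (metis carrier_matD(2) cols_length cols_nth in_set_conv_nth)
    have "v = A *\<^sub>v col B j"
      using col_mult2[OF A B j(1)] j(2) by simp
    also have "A = mat_of_cols n (cols A)"
      using A mat_of_cols_cols[of A] by simp
    also have "col B j = vec (length (cols A)) (($) (col B j))"
      using A B by (intro eq_vecI) auto
    also have "mat_of_cols n (cols A) *\<^sub>v vec (length (cols A)) (($) (col B j))
        = lincomb_list (($) (col B j)) (cols A)"
      using cA by (intro lincomb_list_as_mat_mult[symmetric]) auto
    also have "\<dots> \<in> ?W"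
      unfolding span_list_as_span[OF cA, symmetric] by (auto simp: span_list_def)
    finally show "v \<in> ?W" .
  qed
  then have sub: "?X \<subseteq> ?W"
    using W by (simp add: span_is_subset subspace_def)
  have "subspace class_ring ?X (vs ?W)"
    by (rule nested_subspaces[OF W X sub])
  then show ?thesis
    unfolding rank_def
    using vectorspace.subspace_dim[OF subspace_is_vs[OF W], of ?X] fin_dim_span_cols[OF A]
      fin_dim_span_cols[OF AB] by auto
qed

lemma GL_group_simps:
  "carrier (GL_group n) = Units (ring_mat TYPE(complex) n ())"
  "monoid.mult (GL_group n) = (*)" "one (GL_group n) = 1\<^sub>m n"
  by (simp_all add: GL_group_def units_of_def ring_mat_def)

lemma GL_group_carrier_mat: "x \<in> carrier (GL_group n) \<Longrightarrow> x \<in> carrier_mat n n"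
  by (auto simp: GL_group_simps Units_def ring_mat_def)

lemma GL_group_pseudometric:
  assumes n: "n \<ge> 1"
  shows "right_invariant_pseudometric (GL_group n) (rank_dist n)"
proof -
  interpret R: ring "ring_mat TYPE(complex) n ()" by (rule ring_mat)
  interpret group "GL_group n" unfolding GL_group_def by (rule R.units_group)
  show ?thesis
  proof
    fix x y assume x: "x \<in> carrier (GL_group n)" and y: "y \<in> carrier (GL_group n)"
    note xm = GL_group_carrier_mat[OF x] and ym = GL_group_carrier_mat[OF y]
    show "0 \<le> rank_dist n x y"
      by (simp add: rank_dist_def)
    have "vec_space.rank n (x - y) \<le> n"
      by (rule vec_space.rank_le_nc[OF minus_carrier_mat[OF ym]])
    then show "rank_dist n x y \<le> 1"
      using n by (simp add: rank_dist_def)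
    \<comment> \<open>Symmetry and invariance both come from multiplying by an invertible matrix on the right,
      which by two applications of the product bound preserves the rank.\<close>
    have le: "vec_space.rank n (u - v) \<le> vec_space.rank n (v - u)"
      if "u \<in> carrier_mat n n" "v \<in> carrier_mat n n" for u v :: "complex mat"
    proof -
      have "u - v = (v - u) * (- 1\<^sub>m n)"
        using that by auto
      with rank_mult_le[OF minus_carrier_mat[OF that(1)], of "- 1\<^sub>m n" n] show ?thesis
        by simp
    qed
    show "rank_dist n x y = rank_dist n y x"
      using le[OF xm ym] le[OF ym xm] by (simp add: rank_dist_def)
    fix z assume z: "z \<in> carrier (GL_group n)"
    note zm = GL_group_carrier_mat[OF z]
    have "x - z = (x - y) + (y - z)"
      using xm ym zm by auto
    then have "vec_space.rank n (x - z) \<le> vec_space.rank n (x - y) + vec_space.rank n (y - z)"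
      using vec_space.rank_subadditive[OF minus_carrier_mat[OF ym] minus_carrier_mat[OF zm]] by simp
    then show "rank_dist n x z \<le> rank_dist n x y + rank_dist n y z"
      using n by (simp add: rank_dist_def divide_simps flip: of_nat_add)
    let ?w = "inv\<^bsub>GL_group n\<^esub> z"
    have w: "?w \<in> carrier_mat n n" "z * ?w = 1\<^sub>m n"
      using GL_group_carrier_mat[of ?w n] z r_inv[OF z] by (auto simp: GL_group_simps(2,3))
    note xy = minus_carrier_mat[OF ym, of x]
    have "(x - y) * z * ?w = x - y"
      using assoc_mult_mat[OF xy zm w(1)] w(2) right_mult_one_mat[OF xy] by simp
    then have "vec_space.rank n (x - y) = vec_space.rank n ((x - y) * z)"
      using rank_mult_le[OF xy zm] rank_mult_le[OF mult_carrier_mat[OF xy zm] w(1)]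
      by (simp add: order_antisym)
    moreover have "x * z - y * z = (x - y) * z"
      using xm ym zm by (simp add: minus_mult_distrib_mat)
    ultimately show "rank_dist n (x \<otimes>\<^bsub>GL_group n\<^esub> z) (y \<otimes>\<^bsub>GL_group n\<^esub> z) = rank_dist n x y"
      by (simp add: rank_dist_def GL_group_simps)
  next
    fix x assume "x \<in> carrier (GL_group n)"
    then have "x - x = 0\<^sub>m n n"
      using GL_group_carrier_mat by auto
    then show "rank_dist n x x = 0"
      by (simp add: rank_dist_def vec_space.rank_0I)
  qed
qed

text \<open>Since \<open>x\<^sup>3 - x = (x\<^sup>2 - x) (x + 1)\<close>, the product bound applies.\<close>

lemma rank_dist_square_le:
  assumes x: "x \<in> carrier (GL_group n)"
  shows "rank_dist n (x \<otimes>\<^bsub>GL_group n\<^esub> x \<otimes>\<^bsub>GL_group n\<^esub> x) x \<le> rank_dist n (x \<otimes>\<^bsub>GL_group n\<^esub> x) x"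
proof -
  note xm = GL_group_carrier_mat[OF x]
  have "(x * x - x) * (x + 1\<^sub>m n) = (x * x - x) * x + (x * x - x)"
    using xm minus_carrier_mat[OF xm, of "x * x"] by (simp add: mult_add_distrib_mat[of _ n n _ n])
  also have "(x * x - x) * x = x * x * x - x * x"
    using xm mult_carrier_mat[OF xm xm] by (intro minus_mult_distrib_mat[of _ n n]) auto
  also have "x * x * x - x * x + (x * x - x) = x * x * x - x"
    using xm by (intro eq_matI) auto
  finally have "vec_space.rank n (x * x * x - x) \<le> vec_space.rank n (x * x - x)"
    using rank_mult_le[of "x * x - x" n n "x + 1\<^sub>m n" n] xm minus_carrier_mat[OF xm] by simp
  then show ?thesis
    by (simp add: GL_group_simps rank_dist_def divide_right_mono)
qed

section \<open>Unitary groups\<close>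

lemma mat_adjoint_carrier [simp]:
  fixes A :: "complex mat"
  shows "A \<in> carrier_mat n m \<Longrightarrow> mat_adjoint A \<in> carrier_mat m n"
  by (auto simp: mat_adjoint_def)

lemma mat_adjoint_dim [simp]:
  fixes A :: "complex mat"
  shows "dim_row (mat_adjoint A) = dim_col A" "dim_col (mat_adjoint A) = dim_row A"
  by (simp_all add: mat_adjoint_def)

lemma mat_adjoint_index:
  fixes A :: "complex mat"
  assumes "A \<in> carrier_mat n m" "i < m" "j < n"
  shows "mat_adjoint A $$ (i, j) = cnj (A $$ (j, i))"
  using assms by (auto simp: mat_adjoint_def mat_of_rows_index)

lemma mat_adjoint_mult:
  fixes A B :: "complex mat"
  assumes A: "A \<in> carrier_mat n m" and B: "B \<in> carrier_mat m k"
  shows "mat_adjoint (A * B) = mat_adjoint B * mat_adjoint A"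
proof (rule eq_matI)
  note c = mat_adjoint_carrier[OF A] mat_adjoint_carrier[OF B]
    mat_adjoint_carrier[OF mult_carrier_mat[OF A B]]
  fix i j assume "i < dim_row (mat_adjoint B * mat_adjoint A)" "j < dim_col (mat_adjoint B * mat_adjoint A)"
  then have ij: "i < k" "j < n"
    using c by auto
  have "mat_adjoint (A * B) $$ (i, j) = (\<Sum>l<m. cnj (A $$ (j, l)) * cnj (B $$ (l, i)))"
    using A B ij by (simp add: mat_adjoint_index[OF mult_carrier_mat[OF A B]] scalar_prod_def atLeast0LessThan)
  also have "\<dots> = (mat_adjoint B * mat_adjoint A) $$ (i, j)"
    using A B c ij
    by (simp add: mat_adjoint_index[OF A] mat_adjoint_index[OF B] scalar_prod_def atLeast0LessThan mult.commute)
  finally show "mat_adjoint (A * B) $$ (i, j) = (mat_adjoint B * mat_adjoint A) $$ (i, j)" .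
qed (use A B mat_adjoint_carrier[OF A] mat_adjoint_carrier[OF B]
    mat_adjoint_carrier[OF mult_carrier_mat[OF A B]] in auto)

lemma mat_adjoint_adjoint:
  fixes A :: "complex mat"
  assumes A: "A \<in> carrier_mat n m"
  shows "mat_adjoint (mat_adjoint A) = A"
  using A mat_adjoint_carrier[OF A] mat_adjoint_carrier[OF mat_adjoint_carrier[OF A]]
  by (intro eq_matI) (auto simp: mat_adjoint_index[OF A] mat_adjoint_index[OF mat_adjoint_carrier[OF A]])

text \<open>Both traces are the sum of the squared absolute values of the entries. The first identifies the
  Hilbert-Schmidt metric as a scaled Euclidean metric on the entries; the second makes invariance under
  \<open>A \<mapsto> A z\<close> with \<open>z\<close> unitary evident.\<close>

lemma mat_trace_adjoint_mult:
  assumes A: "A \<in> carrier_mat n n"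
  shows "Re (mat_trace (mat_adjoint A * A)) = (\<Sum>q\<in>{..<n} \<times> {..<n}. (cmod (A $$ q))\<^sup>2)"
    and "Re (mat_trace (A * mat_adjoint A)) = (\<Sum>q\<in>{..<n} \<times> {..<n}. (cmod (A $$ q))\<^sup>2)"
proof -
  note c = mat_adjoint_carrier[OF A]
  have "Re (mat_trace (mat_adjoint A * A)) = (\<Sum>j<n. \<Sum>i<n. (cmod (A $$ (i, j)))\<^sup>2)"
    using A c unfolding cmod_power2
    by (simp add: mat_trace_def mat_adjoint_index[OF A] scalar_prod_def atLeast0LessThan sum.distrib power2_eq_square)
  also have "\<dots> = (\<Sum>i<n. \<Sum>j<n. (cmod (A $$ (i, j)))\<^sup>2)"
    by (rule sum.swap)
  finally show "Re (mat_trace (mat_adjoint A * A)) = (\<Sum>q\<in>{..<n} \<times> {..<n}. (cmod (A $$ q))\<^sup>2)"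
    by (simp add: sum.cartesian_product case_prod_beta)
  have "Re (mat_trace (A * mat_adjoint A)) = (\<Sum>i<n. \<Sum>j<n. (cmod (A $$ (i, j)))\<^sup>2)"
    using A c unfolding cmod_power2
    by (simp add: mat_trace_def mat_adjoint_index[OF A] scalar_prod_def atLeast0LessThan sum.distrib power2_eq_square)
  then show "Re (mat_trace (A * mat_adjoint A)) = (\<Sum>q\<in>{..<n} \<times> {..<n}. (cmod (A $$ q))\<^sup>2)"
    by (simp add: sum.cartesian_product case_prod_beta)
qed

lemma hs_dist_L2:
  assumes "u \<in> carrier_mat n n" "v \<in> carrier_mat n n"
  shows "hs_dist n u v = L2_set (\<lambda>q. cmod (u $$ q - v $$ q)) ({..<n} \<times> {..<n}) / sqrt n"
proof -
  have "(\<Sum>q\<in>{..<n} \<times> {..<n}. (cmod ((u - v) $$ q))\<^sup>2) = (\<Sum>q\<in>{..<n} \<times> {..<n}. (cmod (u $$ q - v $$ q))\<^sup>2)"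
    using assms by (intro sum.cong) auto
  then show ?thesis
    using mat_trace_adjoint_mult(1)[OF minus_carrier_mat[OF assms(2)], of u]
    by (simp add: hs_dist_def L2_set_def real_sqrt_divide)
qed

lemma hs_dist_triangle:
  assumes "u \<in> carrier_mat n n" "v \<in> carrier_mat n n" "w \<in> carrier_mat n n"
  shows "hs_dist n u w \<le> hs_dist n u v + hs_dist n v w"
proof -
  let ?P = "{..<n} \<times> {..<n}"
  have "L2_set (\<lambda>q. cmod (u $$ q - w $$ q)) ?P
      \<le> L2_set (\<lambda>q. cmod (u $$ q - v $$ q) + cmod (v $$ q - w $$ q)) ?P"
    by (intro L2_set_mono) (auto intro: norm_diff_triangle_le)
  also have "\<dots> \<le> L2_set (\<lambda>q. cmod (u $$ q - v $$ q)) ?P + L2_set (\<lambda>q. cmod (v $$ q - w $$ q)) ?P"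
    by (rule L2_set_triangle_ineq)
  finally show ?thesis
    using assms by (simp add: hs_dist_L2 divide_right_mono flip: add_divide_distrib)
qed

text \<open>The defect in the parallelogram law is homogeneous of degree one, so the Euclidean inequality
  below survives every rescaling of the metric.\<close>

lemma parallelogram_defect_scale:
  fixes c :: real
  assumes "c \<ge> 0"
  shows "sqrt (2 * (c * r)\<^sup>2 + 2 * (c * s)\<^sup>2 - (c * t)\<^sup>2) = c * sqrt (2 * r\<^sup>2 + 2 * s\<^sup>2 - t\<^sup>2)"
proof -
  have "2 * (c * r)\<^sup>2 + 2 * (c * s)\<^sup>2 - (c * t)\<^sup>2 = c\<^sup>2 * (2 * r\<^sup>2 + 2 * s\<^sup>2 - t\<^sup>2)"
    by (simp add: power_mult_distrib algebra_simps)
  then show ?thesis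
    using assms by (simp add: real_sqrt_mult)
qed

text \<open>Put \<open>e = 2 m - a - b\<close>. Then \<open>2 (m - z) = (a - z) + (b - z) + e\<close>, so the triangle inequality
  bounds \<open>2 d(m, z)\<close>, and the parallelogram law computes the norm of \<open>e\<close> from the sides of the
  triangle \<open>a, m, b\<close>. When \<open>m\<close> is a metric midpoint of \<open>a\<close> and \<open>b\<close> the square root vanishes:
  Euclidean metrics have unique midpoints and are convex along them.\<close>

lemma hs_dist_euclidean:
  assumes "z \<in> carrier_mat n n" "a \<in> carrier_mat n n" "m \<in> carrier_mat n n" "b \<in> carrier_mat n n"
  shows "2 * hs_dist n m z \<le> hs_dist n a z + hs_dist n b z
    + sqrt (2 * (hs_dist n m a)\<^sup>2 + 2 * (hs_dist n b m)\<^sup>2 - (hs_dist n b a)\<^sup>2)"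
proof -
  let ?P = "{..<n} \<times> {..<n}"
  let ?L = "\<lambda>f. L2_set (\<lambda>q. cmod (f q)) ?P"
  have tri: "?L (\<lambda>q. f q + g q) \<le> ?L f + ?L g" for f g
    by (rule order_trans[OF L2_set_mono L2_set_triangle_ineq]) (auto intro: norm_triangle_ineq)
  have "2 * ?L (\<lambda>q. m $$ q - z $$ q) = L2_set (\<lambda>q. 2 * cmod (m $$ q - z $$ q)) ?P"
    by (simp add: L2_set_right_distrib)
  also have "\<dots> = ?L (\<lambda>q. 2 * (m $$ q - z $$ q))"
    by (simp only: norm_mult norm_numeral)
  also have "\<dots> = ?L (\<lambda>q. (a $$ q - z $$ q) + ((b $$ q - z $$ q) + (2 * m $$ q - a $$ q - b $$ q)))"
    by (simp add: algebra_simps)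
  also have "\<dots> \<le> ?L (\<lambda>q. a $$ q - z $$ q) + (?L (\<lambda>q. b $$ q - z $$ q) + ?L (\<lambda>q. 2 * m $$ q - a $$ q - b $$ q))"
    by (intro order_trans[OF tri] add_left_mono tri)
  also have "?L (\<lambda>q. 2 * m $$ q - a $$ q - b $$ q)
    = sqrt (2 * (?L (\<lambda>q. m $$ q - a $$ q))\<^sup>2 + 2 * (?L (\<lambda>q. b $$ q - m $$ q))\<^sup>2 - (?L (\<lambda>q. b $$ q - a $$ q))\<^sup>2)"
  proof -
    have "(cmod (2 * m $$ q - a $$ q - b $$ q))\<^sup>2 = 2 * (cmod (m $$ q - a $$ q))\<^sup>2
      + 2 * (cmod (b $$ q - m $$ q))\<^sup>2 - (cmod (b $$ q - a $$ q))\<^sup>2" for q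
      unfolding cmod_power2 by (simp add: power2_eq_square algebra_simps)
    then show ?thesis
      by (simp add: L2_set_def sum_nonneg sum_subtractf sum.distrib sum_distrib_left)
  qed
  finally have "1 / sqrt n * (2 * ?L (\<lambda>q. m $$ q - z $$ q))
    \<le> 1 / sqrt n * (?L (\<lambda>q. a $$ q - z $$ q) + (?L (\<lambda>q. b $$ q - z $$ q)
    + sqrt (2 * (?L (\<lambda>q. m $$ q - a $$ q))\<^sup>2 + 2 * (?L (\<lambda>q. b $$ q - m $$ q))\<^sup>2 - (?L (\<lambda>q. b $$ q - a $$ q))\<^sup>2)))"
    by (intro mult_left_mono) auto
  also have "\<dots> = 1 / sqrt n * ?L (\<lambda>q. a $$ q - z $$ q) + 1 / sqrt n * ?L (\<lambda>q. b $$ q - z $$ q)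
    + sqrt (2 * (1 / sqrt n * ?L (\<lambda>q. m $$ q - a $$ q))\<^sup>2 + 2 * (1 / sqrt n * ?L (\<lambda>q. b $$ q - m $$ q))\<^sup>2
      - (1 / sqrt n * ?L (\<lambda>q. b $$ q - a $$ q))\<^sup>2)"
    by (subst parallelogram_defect_scale) (simp_all add: add_divide_distrib)
  finally show ?thesis
    using assms by (simp add: hs_dist_L2)
qed

lemma unitary_group_is_group: "group (unitary_group n)"
proof (rule groupI)
  fix x y assume "x \<in> carrier (unitary_group n)" "y \<in> carrier (unitary_group n)"
  then have x: "x \<in> carrier_mat n n" "mat_adjoint x * x = 1\<^sub>m n" "x * mat_adjoint x = 1\<^sub>m n"
    and y: "y \<in> carrier_mat n n" "mat_adjoint y * y = 1\<^sub>m n" "y * mat_adjoint y = 1\<^sub>m n"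
    by (auto simp: unitary_group_def)
  note c = x(1) y(1) mat_adjoint_carrier[OF x(1)] mat_adjoint_carrier[OF y(1)]
  have "mat_adjoint (x * y) * (x * y) = mat_adjoint y * ((mat_adjoint x * x) * y)"
    using c mult_carrier_mat[OF c(4,3)] mult_carrier_mat[OF c(1,2)] by (simp add: mat_adjoint_mult[OF x(1) y(1)] assoc_mult_mat[of _ n n _ n _ n])
  moreover have "(x * y) * mat_adjoint (x * y) = x * ((y * mat_adjoint y) * mat_adjoint x)"
    using c mult_carrier_mat[OF c(4,3)] mult_carrier_mat[OF c(1,2)] by (simp add: mat_adjoint_mult[OF x(1) y(1)] assoc_mult_mat[of _ n n _ n _ n])
  ultimately show "x \<otimes>\<^bsub>unitary_group n\<^esub> y \<in> carrier (unitary_group n)"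
    using c x y by (simp add: unitary_group_def)
next
  have "mat_adjoint (1\<^sub>m n) = (1\<^sub>m n :: complex mat)"
    using mat_adjoint_carrier[of "1\<^sub>m n :: complex mat" n n]
    by (intro eq_matI) (auto simp: mat_adjoint_index[of _ n n])
  then show "\<one>\<^bsub>unitary_group n\<^esub> \<in> carrier (unitary_group n)"
    by (simp add: unitary_group_def)
next
  fix x assume "x \<in> carrier (unitary_group n)"
  then have "mat_adjoint x \<in> carrier (unitary_group n)" "mat_adjoint x \<otimes>\<^bsub>unitary_group n\<^esub> x = \<one>\<^bsub>unitary_group n\<^esub>"
    by (auto simp: unitary_group_def mat_adjoint_adjoint)
  then show "\<exists>y\<in>carrier (unitary_group n). y \<otimes>\<^bsub>unitary_group n\<^esub> x = \<one>\<^bsub>unitary_group n\<^esub>"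
    by blast
qed (auto simp: unitary_group_def)

lemma unitary_group_pseudometric:
  assumes n: "n \<ge> 1"
  shows "right_invariant_pseudometric (unitary_group n) (\<lambda>u v. 1 / 2 * hs_dist n u v)"
proof -
  interpret group "unitary_group n" by (rule unitary_group_is_group)
  show ?thesis
  proof
    fix x y assume x: "x \<in> carrier (unitary_group n)" and y: "y \<in> carrier (unitary_group n)"
    have xm: "x \<in> carrier_mat n n" and ym: "y \<in> carrier_mat n n"
      using x y by (auto simp: unitary_group_def)
    have symm: "hs_dist n u v = hs_dist n v u"
      if "u \<in> carrier_mat n n" "v \<in> carrier_mat n n" for u v
      using that by (simp add: hs_dist_L2 norm_minus_commute)
    show "0 \<le> 1 / 2 * hs_dist n x y"
      using xm ym by (simp add: hs_dist_L2)
    show "1 / 2 * hs_dist n x y = 1 / 2 * hs_dist n y x"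
      using symm[OF xm ym] by simp
    \<comment> \<open>Unitary matrices lie on the unit sphere, so their mutual distance is at most \<open>2\<close>.\<close>
    have zero: "hs_dist n u (0\<^sub>m n n) = 1" if u: "u \<in> carrier (unitary_group n)" for u
    proof -
      have um: "u \<in> carrier_mat n n"
        using u by (auto simp: unitary_group_def)
      then have "u - 0\<^sub>m n n = u"
        by auto
      then show ?thesis
        using u n by (simp add: hs_dist_def unitary_group_def mat_trace_def)
    qed
    show "1 / 2 * hs_dist n x y \<le> 1"
      using hs_dist_triangle[OF xm zero_carrier_mat ym] symm[OF zero_carrier_mat ym] zero[OF x] zero[OF y]
      by simp
    fix z assume z: "z \<in> carrier (unitary_group n)"
    then have zm: "z \<in> carrier_mat n n" "z * mat_adjoint z = 1\<^sub>m n"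
      by (auto simp: unitary_group_def)
    show "1 / 2 * hs_dist n x z \<le> 1 / 2 * hs_dist n x y + 1 / 2 * hs_dist n y z"
      using hs_dist_triangle[OF xm ym zm(1)] by simp
    let ?A = "x - y"
    have A: "?A \<in> carrier_mat n n"
      using ym by (rule minus_carrier_mat)
    have "(?A * z) * mat_adjoint (?A * z) = ?A * ((z * mat_adjoint z) * mat_adjoint ?A)"
      using A zm(1) mat_adjoint_carrier[OF A] mult_carrier_mat[OF mat_adjoint_carrier[OF zm(1)] mat_adjoint_carrier[OF A]]
      by (simp add: mat_adjoint_mult[OF A zm(1)] assoc_mult_mat[of _ n n _ n _ n])
    then have eq: "(?A * z) * mat_adjoint (?A * z) = ?A * mat_adjoint ?A"
      using zm(2) left_mult_one_mat[OF mat_adjoint_carrier[OF A]] by simp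
    have "x * z - y * z = ?A * z"
      using xm ym zm by (simp add: minus_mult_distrib_mat)
    then have "hs_dist n (x * z) (y * z) = hs_dist n x y"
      using mat_trace_adjoint_mult[OF A] mat_trace_adjoint_mult[OF mult_carrier_mat[OF A zm(1)]] eq
      by (simp add: hs_dist_def)
    then show "1 / 2 * hs_dist n (x \<otimes>\<^bsub>unitary_group n\<^esub> z) (y \<otimes>\<^bsub>unitary_group n\<^esub> z) = 1 / 2 * hs_dist n x y"
      by (simp add: unitary_group_def)
  next
    fix x assume "x \<in> carrier (unitary_group n)"
    then show "1 / 2 * hs_dist n x x = 0"
      by (simp add: unitary_group_def hs_dist_L2 L2_set_def)
  qed
qed

lemma half_hs_dist_euclidean:
  assumes "z \<in> carrier (unitary_group n)" "a \<in> carrier (unitary_group n)"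
    "m \<in> carrier (unitary_group n)" "b \<in> carrier (unitary_group n)"
  shows "2 * (1 / 2 * hs_dist n m z) \<le> 1 / 2 * hs_dist n a z + 1 / 2 * hs_dist n b z
    + sqrt (2 * (1 / 2 * hs_dist n m a)\<^sup>2 + 2 * (1 / 2 * hs_dist n b m)\<^sup>2 - (1 / 2 * hs_dist n b a)\<^sup>2)"
proof -
  have "0 \<le> (1 / 2 :: real)"
    by simp
  note half = parallelogram_defect_scale[OF this]
  show ?thesis
    unfolding half using hs_dist_euclidean[of z n a m b] assms by (simp add: unitary_group_def)
qed

section \<open>The Lee metric is not sofic, hyperlinear or linear sofic\<close>

theorem theorem2p6:
  fixes p :: nat
  assumes "prime p" and "p \<ge> 13"
  shows "(integer_mod_group p, lee_dist p) \<notin>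
    sofic_metric_groups TYPE('i) \<union>
    hyperlinear_metric_groups TYPE('j) \<union>
    linear_sofic_metric_groups TYPE('k)"
proof -
  have p: "p \<ge> 5" "odd p"
    using assms prime_odd_nat by auto
  have "(integer_mod_group p, lee_dist p) \<notin> sofic_metric_groups TYPE('i)"
  proof -
    have "\<not> isometric_hom (integer_mod_group p) (lee_dist p)
        (ultraproduct \<Phi> (\<lambda>i. sym_group (n i)) (\<lambda>i. hamming_dist (n i)))
        (ultraproduct_dist \<Phi> (\<lambda>i. sym_group (n i)) (\<lambda>i. hamming_dist (n i))) h"
      if "ultrafilter \<Phi>" "\<forall>i. n i \<ge> 1" for \<Phi> :: "'i filter" and n h
      using that by (intro lee_not_embeddable_if_squaring_contracts p sym_group_pseudometric hamming_dist_square_le) auto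
    then show ?thesis
      unfolding sofic_metric_groups_def Let_def by blast
  qed
  moreover have "(integer_mod_group p, lee_dist p) \<notin> hyperlinear_metric_groups TYPE('j)"
  proof -
    have "\<not> isometric_hom (integer_mod_group p) (lee_dist p)
        (ultraproduct \<Phi> (\<lambda>i. unitary_group (n i)) (\<lambda>i u v. 1 / 2 * hs_dist (n i) u v))
        (ultraproduct_dist \<Phi> (\<lambda>i. unitary_group (n i)) (\<lambda>i u v. 1 / 2 * hs_dist (n i) u v)) h"
      if "ultrafilter \<Phi>" "\<forall>i. n i \<ge> 1" for \<Phi> :: "'j filter" and n h
      using that by (intro lee_not_embeddable_if_euclidean p unitary_group_pseudometric half_hs_dist_euclidean) auto
    then show ?thesis
      unfolding hyperlinear_metric_groups_def Let_def by blast
  qed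
  moreover have "(integer_mod_group p, lee_dist p) \<notin> linear_sofic_metric_groups TYPE('k)"
  proof -
    have "\<not> isometric_hom (integer_mod_group p) (lee_dist p)
        (ultraproduct \<Phi> (\<lambda>i. GL_group (n i)) (\<lambda>i. rank_dist (n i)))
        (ultraproduct_dist \<Phi> (\<lambda>i. GL_group (n i)) (\<lambda>i. rank_dist (n i))) h"
      if "ultrafilter \<Phi>" "\<forall>i. n i \<ge> 1" for \<Phi> :: "'k filter" and n h
      using that by (intro lee_not_embeddable_if_squaring_contracts p GL_group_pseudometric rank_dist_square_le) auto
    then show ?thesis
      unfolding linear_sofic_metric_groups_def Let_def by blast
  qed
  ultimately show ?thesis
    by blast
qed

end
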